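(* For each integer $k\geq 1$ define $$f(k):=\sum_{1\leq m_1,m_2,m_3\leq k}\frac{1}{(m_1+m_2)(m_2+m_3)(m_1+m_3)}-\int_{[1,k+1]^3}\frac{dx\,dy\,dz}{(x+y)(y+z)(z+x)}.$$ Then $$\lim_{k\rightarrow +\infty}f(k)=\frac{3}{2}\zeta(2)\gamma+\frac{1}{8}\zeta(3).$$
   Context: The sum is over all triples of integers $m_1,m_2,m_3$ with $1\le m_i\le k$. $\zeta$ is the Riemann zeta function, and $\gamma$ is the Euler constant $$\gamma:=\lim_{k\rightarrow +\infty}\left(\sum_{1\leq n\leq k}\frac{1}{n}-\log k\right)=\lim_{k\rightarrow +\infty}\left(\sum_{1\leq n\leq k}\frac{1}{n}-\int_1^{k+1}\frac{dt}{t}\right).$$ *)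

theory Defs
  imports "HOL-Analysis.Analysis"
begin

text \<open>
  The Riemann zeta function on the real half-line \<open>s > 1\<close>, where it is given by its Dirichlet
  series. For \<open>s \<le> 1\<close> the series diverges and the value below is meaningless; in
  particular it is not the analytic continuation.
\<close>
definition zeta :: "real \<Rightarrow> real" where
  "zeta s = (\<Sum>n. 1 / real (Suc n) powr s)"

lemma zeta_sums:
  assumes "s > 1"
  shows "(\<lambda>n. 1 / real (Suc n) powr s) sums zeta s"
proof -
  have "summable (\<lambda>n. real n powr (- s))"
    using assms by (simp add: summable_real_powr_iff)
  hence "summable (\<lambda>n. real (Suc n) powr (- s))"
    by (subst summable_Suc_iff)
  hence "summable (\<lambda>n. 1 / real (Suc n) powr s)"
    by (simp add: powr_minus_divide)
  thus ?thesis
    unfolding zeta_def by (rule summable_sums)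
qed

definition f :: "nat \<Rightarrow> real" where
  "f k =
     (\<Sum>(m1, m2, m3) \<in> {1..k} \<times> {1..k} \<times> {1..k}.
        1 / (real (m1 + m2) * real (m2 + m3) * real (m1 + m3)))
     - integral ({1..real k + 1} \<times> {1..real k + 1} \<times> {1..real k + 1})
         (\<lambda>(x, y, z). 1 / ((x + y) * (y + z) * (z + x)))"

text \<open>The integral in \<open>f\<close> exists, so it is not the default value \<open>0\<close> of a divergent integral.\<close>
lemma f_integrable:
  "(\<lambda>(x, y, z). 1 / ((x + y) * (y + z) * (z + x))) integrable_on
     ({1..real k + 1} \<times> {1..real k + 1} \<times> {1..real k + 1})"
proof -
  let ?B = "{1..real k + 1} \<times> {1..real k + 1} \<times> {1..real k + 1}"
  have B: "?B = cbox (1, 1, 1) (real k + 1, real k + 1, real k + 1)"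
    by (simp add: cbox_Pair_eq)
  have "continuous_on ?B (\<lambda>p. 1 / ((fst p + fst (snd p)) *
          (fst (snd p) + snd (snd p)) * (snd (snd p) + fst p)))"
    by (intro continuous_intros) auto
  hence "continuous_on ?B (\<lambda>(x, y, z). 1 / ((x + y) * (y + z) * (z + x)))"
    by (simp add: case_prod_unfold)
  thus ?thesis
    unfolding B by (rule integrable_continuous)
qed

end

theory Submission
  imports Defs
begin

text \<open>
  Write \<open>g m\<close> for the summand at a lattice point \<open>m = (a, b, c)\<close> and \<open>w m\<close> for the integral of
  \<open>1 / ((x + y) (y + z) (z + x))\<close> over the unit cube with lower corner \<open>m\<close>. Cutting \<open>[1, k + 1]^3\<close>
  into unit cubes turns \<open>f k\<close> into the sum of the defects \<open>g m - w m\<close> over \<open>1 \<le> a, b, c \<le> k\<close>. The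
  integrand is decreasing in each variable, so every defect is nonnegative, and the limit of \<open>f\<close> is
  the unordered sum of all defects. An unordered sum may be arranged at will, and here it is
  arranged by shells: the shell of \<open>a\<close> consists of the points whose smallest coordinate is \<open>a\<close>. Both
  halves of the defect have a closed form on a shell.

  The lattice sum over the shell of \<open>a\<close> is exactly \<open>C / a + 1 / (8 a^3)\<close> with \<open>C = 3/2 zeta 2\<close>
  (\<open>shell_sum\<close>). The second term is the point \<open>(a, a, a)\<close>. The remaining points fall into three
  cyclic rotations of \<open>{(a, b, c). a \<le> b \<and> a < c}\<close>, and each rotation contributes
  \<open>zeta 2 / (2 a)\<close>: partial fractions and an exchange of summations reduce this to the single series
  in \<open>harmonic_block_sums\<close>, whose value \<open>zeta 2\<close> does not depend on its parameter.

  The integral \<open>V a\<close> over the shell of \<open>a\<close> is \<open>C (ln (a + 1) - ln a)\<close> (\<open>shell_integral_eq\<close>), and no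
  integral has to be evaluated to see this. The integrand is homogeneous of degree \<open>-3\<close>, so
  dilation by \<open>n\<close> shows that \<open>V a\<close> is the sum of \<open>V j\<close> over \<open>n a \<le> j < n a + n\<close>. Monotonicity puts
  \<open>V j\<close> between the lattice sums over the shells of \<open>j + 1\<close> and \<open>j\<close>, so \<open>V j\<close> differs from
  \<open>C (ln (j + 1) - ln j)\<close> by at most a constant times \<open>1 / j - 1 / (j + 1)\<close>. Adding up over the block
  bounds the error at \<open>a\<close> by a constant times \<open>1 / n\<close>, for every \<open>n\<close>.

  The total defect is thus the sum over \<open>a\<close> of \<open>C (1 / a - ln (a + 1) + ln a) + 1 / (8 a^3)\<close>, that
  is, \<open>C\<close> times the Euler constant plus \<open>zeta 3 / 8\<close>.
\<close>

section \<open>Unordered sums along the fibres of a map\<close>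

lemma has_sum_fibres:
  fixes f :: "'a \<Rightarrow> real"
  assumes f: "(f has_sum S) U"
    and h: "\<And>m. m \<in> U \<Longrightarrow> h m \<in> A"
    and g: "\<And>x. x \<in> A \<Longrightarrow> (f has_sum g x) {m \<in> U. h m = x}"
  shows "(g has_sum S) A"
proof (rule has_sum_SigmaD)
  show "((\<lambda>p. f (snd p)) has_sum S) (Sigma A (\<lambda>x. {m \<in> U. h m = x}))"
    using f by (subst has_sum_reindex_bij_witness[of _ "\<lambda>m. (h m, m)" snd U f]) (auto intro: h)
qed (simp add: g)

text \<open>
  Nonnegativity supplies what the converse needs: summability over the union of all fibres.
\<close>
lemma has_sum_of_fibres:
  fixes f :: "'a \<Rightarrow> real"
  assumes g: "(g has_sum S) A"
    and h: "\<And>m. m \<in> U \<Longrightarrow> h m \<in> A"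
    and fib: "\<And>x. x \<in> A \<Longrightarrow> (f has_sum g x) {m \<in> U. h m = x}"
    and nonneg: "\<And>m. m \<in> U \<Longrightarrow> f m \<ge> 0"
  shows "(f has_sum S) U"
proof -
  let ?P = "Sigma A (\<lambda>x. {m \<in> U. h m = x})"
  have "(\<lambda>p. f (snd p)) summable_on ?P"
    using nonneg by (intro summable_on_SigmaI[where g = g]) (use fib g in \<open>auto simp: has_sum_imp_summable\<close>)
  then have "((\<lambda>p. f (snd p)) has_sum S) ?P"
    by (intro has_sum_SigmaI[where g = g]) (use fib g in auto)
  then show ?thesis
    by (subst has_sum_reindex_bij_witness[of U snd "\<lambda>m. (h m, m)" ?P "\<lambda>p. f (snd p)"])
      (auto intro: h)
qed

section \<open>A two-variable series with value zeta(2)\<close>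

lemma telescoping_sums:
  fixes p :: real
  shows "(\<lambda>x. 1 / (real x + p) - 1 / (real x + p + real d)) sums (\<Sum>i<d. 1 / (p + real i))"
proof (induction d)
  case (Suc d)
  have "(\<lambda>x. 1 / ((p + real d) + real x)) \<longlonglongrightarrow> 0"
    by (intro tendsto_divide_0[OF tendsto_const] filterlim_at_top_imp_at_infinity
        filterlim_tendsto_add_at_top[OF tendsto_const] filterlim_real_sequentially)
  from telescope_sums'[OF this]
  have "(\<lambda>x. 1 / (real x + p + real d) - 1 / (real x + p + real (Suc d))) sums (1 / (p + real d))"
    by (simp add: algebra_simps)
  from sums_add[OF Suc this] show ?case
    by simp
qed simp

text \<open>
  With harmonic numbers \<open>H\<close> the series is the sum over \<open>j \<ge> N\<close> of \<open>(H j - H (j - N)) / j\<close>. Passing from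
  \<open>N\<close> to \<open>N + 1\<close> removes the term \<open>H N / N\<close> at \<open>j = N\<close> and adds \<open>1 / (j (j - N))\<close> to each of the others;
  the additions telescope to \<open>H N / N\<close> as well, so the value stays that of \<open>N = 1\<close>, which is \<open>zeta 2\<close>.
\<close>
lemma harmonic_block_sums:
  assumes "N \<ge> 1"
  shows "(\<lambda>l. (\<Sum>i<N. 1 / real (l + 1 + i)) / real (N + l)) sums zeta 2"
  using assms
proof (induction N rule: nat_induct_at_least)
  case base
  show ?case
    using zeta_sums[of 2] by (simp add: powr_numeral power2_eq_square add_ac)
next
  case (Suc N)
  define a where "a = (\<lambda>N l. (\<Sum>i<N. 1 / real (l + 1 + i)) / real (N + l))"
  have "(\<lambda>l. (1 / (real l + 1) - 1 / (real l + 1 + real N)) / real N) sums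
          ((\<Sum>i<N. 1 / (1 + real i)) / real N)"
    by (intro sums_divide telescoping_sums)
  (* The same j = N + 1 + l stands at index l for Suc N but at index Suc l for N. *)
  moreover have "(1 / (real l + 1) - 1 / (real l + 1 + real N)) / real N
                   = a (Suc N) l - a N (Suc l)" for l
  proof -
    have "a (Suc N) l = (1 / real (l + 1) + (\<Sum>i<N. 1 / real (Suc l + 1 + i))) / real (N + Suc l)"
      unfolding a_def by (subst sum.lessThan_Suc_shift) (simp add: add_ac)
    then have "a (Suc N) l - a N (Suc l) = 1 / real (l + 1) / real (N + Suc l)"
      unfolding a_def by (simp add: diff_divide_distrib add_divide_distrib)
    also have "\<dots> = (1 / (real l + 1) - 1 / (real l + 1 + real N)) / real N"
      using Suc.hyps by (simp add: divide_simps) (simp add: algebra_simps)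
    finally show ?thesis by simp
  qed
  ultimately have "(\<lambda>l. a (Suc N) l - a N (Suc l)) sums a N 0"
    by (simp add: a_def add_ac)
  moreover have "(\<lambda>l. a N (Suc l)) sums (zeta 2 - a N 0)"
    using Suc.IH unfolding a_def by (subst sums_Suc_iff) simp
  ultimately have "(\<lambda>l. a (Suc N) l - a N (Suc l) + a N (Suc l)) sums (a N 0 + (zeta 2 - a N 0))"
    by (rule sums_add)
  then show ?case
    by (simp add: a_def add_ac)
qed

text \<open>
  Summing over \<open>x\<close> first telescopes, because
  \<open>1 / ((N + x) (N + x + d)) = (1 / (N + x) - 1 / (N + x + d)) / d\<close>. What remains is \<open>1 / N\<close> times the
  sum of the terms \<open>u (l, d)\<close> below over \<open>l < d\<close>. Summing those over \<open>d\<close> first telescopes again and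
  leaves the series of \<open>harmonic_block_sums\<close>.
\<close>
lemma two_variable_sum:
  assumes "N \<ge> 1"
  shows "((\<lambda>(x, d). 1 / (real (N + x) * real (N + x + d) * real (N + d))) has_sum zeta 2 / real N)
           {(x, d). d \<ge> 1}"
proof -
  have N: "real N > 0" using assms by simp
  define u where "u = (\<lambda>(l, d). (1 / real d - 1 / real (d + N)) / real (N + l))"
  define U where "U = {(l, d::nat). l < d}"
  have gap: "1 / real d - 1 / real (d + N) \<ge> 0" if "d \<ge> 1" for d
    using that by (simp add: frac_le)
  have u_nonneg: "u m \<ge> 0" if "m \<in> U" for m
    using that gap unfolding u_def U_def by (auto intro!: divide_nonneg_nonneg)
  have "(u has_sum zeta 2) U"
  proof (rule has_sum_of_fibres[where h = fst and A = UNIV])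
    show "((\<lambda>l. (\<Sum>i<N. 1 / real (l + 1 + i)) / real (N + l)) has_sum zeta 2) UNIV"
      by (intro sums_nonneg_imp_has_sum harmonic_block_sums assms divide_nonneg_nonneg sum_nonneg)
         auto
    show "(u has_sum (\<Sum>i<N. 1 / real (l + 1 + i)) / real (N + l)) {m \<in> U. fst m = l}" for l
    proof -
      have "((\<lambda>x. u (l, x + l + 1)) has_sum (\<Sum>i<N. 1 / real (l + 1 + i)) / real (N + l)) UNIV"
      proof (rule sums_nonneg_imp_has_sum)
        have "(\<lambda>x. (1 / (real x + (real l + 1)) - 1 / (real x + (real l + 1) + real N)) / real (N + l))
                sums ((\<Sum>i<N. 1 / ((real l + 1) + real i)) / real (N + l))"
          by (intro sums_divide telescoping_sums)
        then show "(\<lambda>x. u (l, x + l + 1)) sums ((\<Sum>i<N. 1 / real (l + 1 + i)) / real (N + l))"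
          by (simp add: u_def add_ac)
      qed (rule u_nonneg, simp add: U_def)
      then show ?thesis
        by (subst has_sum_reindex_bij_witness[of _ "\<lambda>x. (l, x + l + 1)" "\<lambda>m. snd m - l - 1" UNIV
              "\<lambda>x. u (l, x + l + 1)"]) (auto simp: U_def)
    qed
  qed (auto intro: u_nonneg)
  then have by_d: "((\<lambda>d. \<Sum>l<d. u (l, d)) has_sum zeta 2) {1..}"
  proof (rule has_sum_fibres[where h = snd])
    fix d :: nat
    have "((\<lambda>l. u (l, d)) has_sum (\<Sum>l<d. u (l, d))) {..<d}"
      by simp
    then show "(u has_sum (\<Sum>l<d. u (l, d))) {m \<in> U. snd m = d}"
      by (subst has_sum_reindex_bij_witness[of _ "\<lambda>l. (l, d)" fst "{..<d}" "\<lambda>l. u (l, d)"])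
         (auto simp: U_def)
  qed (auto simp: U_def)
  show ?thesis
  proof (rule has_sum_of_fibres[where h = snd and A = "{1..}"])
    show "((\<lambda>d. (\<Sum>l<d. u (l, d)) / real N) has_sum zeta 2 / real N) {1..}"
      by (intro has_sum_divide_const by_d)
    fix d :: nat assume "d \<in> {1..}"
    then have d: "d \<ge> 1" by simp
    define t where "t = (\<lambda>x. 1 / (real (N + x) * real (N + x + d) * real (N + d)))"
    have "(t has_sum (\<Sum>l<d. u (l, d)) / real N) UNIV"
    proof (rule sums_nonneg_imp_has_sum)
      have "(\<lambda>x. (1 / (real x + real N) - 1 / (real x + real N + real d)) * (1 / (real d * real (N + d))))
              sums ((\<Sum>l<d. 1 / (real N + real l)) * (1 / (real d * real (N + d))))"
        by (intro sums_mult2 telescoping_sums)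
      also have "(\<Sum>l<d. 1 / (real N + real l)) * (1 / (real d * real (N + d)))
                   = (\<Sum>l<d. u (l, d)) / real N"
      proof -
        have "1 / (real N + real l) * (1 / (real d * real (N + d))) = u (l, d) / real N" for l
        proof -
          have "1 / (real d * real (N + d)) = (1 / real d - 1 / real (d + N)) / real N"
            using d N by (simp add: divide_simps)
          then show ?thesis by (simp add: u_def)
        qed
        then show ?thesis
          unfolding sum_divide_distrib sum_distrib_right by simp
      qed
      also have "(\<lambda>x. (1 / (real x + real N) - 1 / (real x + real N + real d)) * (1 / (real d * real (N + d)))) = t"
        using d N by (simp add: t_def fun_eq_iff divide_simps add_pos_nonneg) (simp add: algebra_simps)
      finally show "t sums ((\<Sum>l<d. u (l, d)) / real N)" .
    qed (simp add: t_def)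
    then show "((\<lambda>(x, d). 1 / (real (N + x) * real (N + x + d) * real (N + d))) has_sum
            (\<Sum>l<d. u (l, d)) / real N) {m \<in> {(x, d). d \<ge> 1}. snd m = d}"
      by (subst has_sum_reindex_bij_witness[of _ "\<lambda>x. (x, d)" fst UNIV t])
         (use d in \<open>auto simp: t_def\<close>)
  qed (auto simp: split_beta)
qed

section \<open>The lattice sum over a shell\<close>

definition lattice_term :: "nat \<times> nat \<times> nat \<Rightarrow> real" where
  "lattice_term = (\<lambda>(a, b, c). 1 / (real (a + b) * real (b + c) * real (a + c)))"

definition shell :: "nat \<Rightarrow> (nat \<times> nat \<times> nat) set" where
  "shell a = {(x, y, z). min x (min y z) = a}"

text \<open>
  The mixed strict and non-strict inequalities make each off-diagonal point of the shell lie in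
  exactly one cyclic rotation of the wedge, also when its minimum is attained twice.
\<close>
definition wedge :: "nat \<Rightarrow> (nat \<times> nat \<times> nat) set" where
  "wedge a = {(x, y, z). x = a \<and> a \<le> y \<and> a < z}"

definition rotate_triple :: "nat \<times> nat \<times> nat \<Rightarrow> nat \<times> nat \<times> nat" where
  "rotate_triple = (\<lambda>(a, b, c). (b, c, a))"

lemma lattice_term_nonneg: "lattice_term m \<ge> 0"
  by (auto simp: lattice_term_def split_beta)

lemma lattice_term_rotate: "lattice_term (rotate_triple m) = lattice_term m"
  by (auto simp: lattice_term_def rotate_triple_def split_beta mult_ac add_ac)

lemma inj_rotate_triple: "inj rotate_triple"
  by (auto simp: inj_def rotate_triple_def)

lemma has_sum_rotate:
  assumes "(lattice_term has_sum S) A"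
  shows "(lattice_term has_sum S) (rotate_triple ` A)"
  using assms
  by (subst has_sum_reindex) (auto simp: o_def lattice_term_rotate intro: inj_on_subset[OF inj_rotate_triple])

text \<open>
  With \<open>b = a + x\<close> and \<open>c = a + d\<close> the denominators are \<open>2 a + x\<close>, \<open>2 a + x + d\<close> and \<open>2 a + d\<close>, so this
  is the two-variable series at \<open>N = 2 a\<close>.
\<close>
lemma wedge_sum:
  assumes "a \<ge> 1"
  shows "(lattice_term has_sum zeta 2 / real (2 * a)) (wedge a)"
  using two_variable_sum[of "2 * a"] assms
  by (subst has_sum_reindex_bij_witness[of _ "\<lambda>(x, d). (a, a + x, a + d)" "\<lambda>(_, y, z). (y - a, z - a)"
        "{(x, d). d \<ge> 1}" "\<lambda>(x, d). 1 / (real (2 * a + x) * real (2 * a + x + d) * real (2 * a + d))"])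
     (auto simp: wedge_def lattice_term_def algebra_simps)

lemma shell_decomposition:
  "shell a = {(a, a, a)} \<union> (wedge a \<union> (rotate_triple ` wedge a \<union> rotate_triple ` rotate_triple ` wedge a))"
proof -
  have "rotate_triple ` wedge a = {(x, y, z). z = a \<and> a \<le> x \<and> a < y}"
    unfolding rotate_triple_def wedge_def by (auto simp: image_iff)
  moreover have "rotate_triple ` {(x, y, z). z = a \<and> a \<le> x \<and> a < y} = {(x, y, z). y = a \<and> a \<le> z \<and> a < x}"
    unfolding rotate_triple_def by (auto simp: image_iff)
  ultimately show ?thesis
    unfolding shell_def wedge_def by (auto simp: min_def split: if_splits)
qed

lemma shell_sum:
  assumes "a \<ge> 1"
  shows "(lattice_term has_sum 3 / 2 * zeta 2 / real a + 1 / (8 * real a ^ 3)) (shell a)"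
proof -
  note w = wedge_sum[OF assms]
  have diag: "(lattice_term has_sum 1 / (8 * real a ^ 3)) {(a, a, a)}"
    by (simp add: has_sum_finite_iff lattice_term_def power3_eq_cube)
  have "(lattice_term has_sum 1 / (8 * real a ^ 3)
           + (zeta 2 / real (2 * a) + (zeta 2 / real (2 * a) + zeta 2 / real (2 * a)))) (shell a)"
    unfolding shell_decomposition
    by (intro has_sum_Un_disjoint diag w has_sum_rotate) (auto simp: wedge_def rotate_triple_def)
  moreover have "1 / (8 * real a ^ 3) + (zeta 2 / real (2 * a) + (zeta 2 / real (2 * a) + zeta 2 / real (2 * a)))
                  = 3 / 2 * zeta 2 / real a + 1 / (8 * real a ^ 3)"
    by (simp add: field_simps)
  ultimately show ?thesis by metis
qed

section \<open>Integrals over lattice cubes\<close>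

definition kernel :: "real \<times> real \<times> real \<Rightarrow> real" where
  "kernel = (\<lambda>(x, y, z). 1 / ((x + y) * (y + z) * (z + x)))"

definition cell :: "nat \<times> nat \<times> nat \<Rightarrow> (real \<times> real \<times> real) set" where
  "cell = (\<lambda>(a, b, c). {real a..real a + 1} \<times> {real b..real b + 1} \<times> {real c..real c + 1})"

definition cell_integral :: "nat \<times> nat \<times> nat \<Rightarrow> real" where
  "cell_integral m = integral (cell m) kernel"

definition cube :: "nat \<Rightarrow> nat \<times> nat \<times> nat \<Rightarrow> (nat \<times> nat \<times> nat) set" where
  "cube n = (\<lambda>(a, b, c). {a..<a + n} \<times> {b..<b + n} \<times> {c..<c + n})"

lemma kernel_integrable:
  assumes "a > 0" "b > 0" "c > 0"
  shows "kernel integrable_on cbox (a, b, c) (a', b', c')"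
proof (rule integrable_continuous)
  have "continuous_on (cbox (a, b, c) (a', b', c')) (\<lambda>p. 1 / ((fst p + fst (snd p)) *
          (fst (snd p) + snd (snd p)) * (snd (snd p) + fst p)))"
    using assms by (intro continuous_intros) (auto simp: cbox_Pair_eq)
  then show "continuous_on (cbox (a, b, c) (a', b', c')) kernel"
    by (simp add: kernel_def case_prod_unfold)
qed

lemma cell_eq_cbox:
  "cell (a, b, c) = cbox (real a, real b, real c) (real a + 1, real b + 1, real c + 1)"
  by (simp add: cell_def cbox_Pair_eq)

lemma cell_has_integral:
  assumes "a \<ge> 1" "b \<ge> 1" "c \<ge> 1"
  shows "(kernel has_integral cell_integral (a, b, c)) (cell (a, b, c))"
  unfolding cell_integral_def cell_eq_cbox
  using assms by (intro integrable_integral kernel_integrable) auto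

lemma Union_unit_intervals:
  assumes "n \<ge> 1"
  shows "(\<Union>i\<in>{a..<a + n}. {real i..real i + 1}) = {real a..real a + real n}"
  using assms
proof (induction n rule: nat_induct_at_least)
  case (Suc n)
  have "{a..<a + Suc n} = insert (a + n) {a..<a + n}" by auto
  with Suc show ?case by (auto simp: algebra_simps)
qed auto

lemma negligible_cell_Int:
  assumes "m \<noteq> m'"
  shows "negligible (cell m \<inter> cell m')"
proof -
  obtain a b c where m: "m = (a, b, c)" by (cases m)
  obtain a' b' c' where m': "m' = (a', b', c')" by (cases m')
  let ?l = "(max (real a) (real a'), max (real b) (real b'), max (real c) (real c'))"
  let ?u = "(min (real a + 1) (real a' + 1), min (real b + 1) (real b' + 1), min (real c + 1) (real c' + 1))"
  have "cell m \<inter> cell m' = cbox ?l ?u"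
    unfolding m m' cell_eq_cbox by (auto simp: cbox_Pair_eq)
  moreover have "box ?l ?u = {}"
  proof -
    have gap: "min (real i + 1) (real j + 1) \<le> max (real i) (real j)" if "i \<noteq> j" for i j :: nat
      using that by (cases "i < j") auto
    have "(1, 0, 0) \<in> (Basis :: (real \<times> real \<times> real) set)"
         "(0, 1, 0) \<in> (Basis :: (real \<times> real \<times> real) set)"
         "(0, 0, 1) \<in> (Basis :: (real \<times> real \<times> real) set)"
      by (auto simp: Basis_prod_def zero_prod_def)
    moreover have "a \<noteq> a' \<or> b \<noteq> b' \<or> c \<noteq> c'"
      using assms m m' by simp
    ultimately have "\<exists>i\<in>Basis. ?u \<bullet> i \<le> ?l \<bullet> i"
      using gap[of a a'] gap[of b b'] gap[of c c']
      by (elim disjE) (rule bexI[of _ "(1, 0, 0)"] bexI[of _ "(0, 1, 0)"] bexI[of _ "(0, 0, 1)"], simp, assumption)+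
    then show ?thesis
      by (simp add: box_eq_empty)
  qed
  ultimately show ?thesis
    by (simp add: negligible_interval)
qed

lemma cube_has_integral:
  assumes "a \<ge> 1" "b \<ge> 1" "c \<ge> 1" "n \<ge> 1"
  shows "(kernel has_integral (\<Sum>m\<in>cube n (a, b, c). cell_integral m))
           ({real a..real a + real n} \<times> {real b..real b + real n} \<times> {real c..real c + real n})"
proof -
  have "(kernel has_integral (\<Sum>m\<in>cube n (a, b, c). cell_integral m)) (\<Union>m\<in>cube n (a, b, c). cell m)"
  proof (rule has_integral_UN)
    fix m assume "m \<in> cube n (a, b, c)"
    then show "(kernel has_integral cell_integral m) (cell m)"
      using assms by (cases m) (auto simp: cube_def intro!: cell_has_integral)
  qed (auto simp: cube_def pairwise_def intro: negligible_cell_Int)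
  also have "(\<Union>m\<in>cube n (a, b, c). cell m)
      = (\<Union>i\<in>{a..<a + n}. {real i..real i + 1}) \<times> (\<Union>i\<in>{b..<b + n}. {real i..real i + 1})
          \<times> (\<Union>i\<in>{c..<c + n}. {real i..real i + 1})"
    by (fastforce simp: cube_def cell_def)
  finally show ?thesis
    unfolding Union_unit_intervals[OF assms(4)] .
qed

text \<open>
  Homogeneity of degree \<open>-3\<close> cancels the volume factor of a dilation in three dimensions, which is
  why the integral over a cell survives the dilation unchanged in the next lemma.
\<close>
lemma kernel_scale: "kernel (t *\<^sub>R p) = kernel p / t ^ 3"
proof -
  obtain x y z where p: "p = (x, y, z)" by (cases p)
  have "(t * x + t * y) * (t * y + t * z) * (t * z + t * x) = t ^ 3 * ((x + y) * (y + z) * (z + x))"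
    by (simp add: power3_eq_cube algebra_simps)
  then show ?thesis
    by (simp add: p kernel_def mult.commute)
qed

text \<open>
  The cell dilated by \<open>n\<close> has side \<open>n\<close> and lower corner \<open>(n a, n b, n c)\<close>, so it splits into \<open>n^3\<close> cells.
\<close>
lemma cell_integral_subdivide:
  assumes "a \<ge> 1" "b \<ge> 1" "c \<ge> 1" "n \<ge> 1"
  shows "cell_integral (a, b, c) = (\<Sum>m\<in>cube n (n * a, n * b, n * c). cell_integral m)"
proof -
  define I where "I = (\<Sum>m\<in>cube n (n * a, n * b, n * c). cell_integral m)"
  have n: "real n > 0" using assms by simp
  have pos: "n * a \<ge> 1" "n * b \<ge> 1" "n * c \<ge> 1"
    using assms by simp_all
  have "(kernel has_integral I) (cbox (real n * real a, real n * real b, real n * real c)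
          (real n * real a + real n, real n * real b + real n, real n * real c + real n))"
    using cube_has_integral[OF pos assms(4)] by (simp add: I_def cbox_Pair_eq)
  from has_integral_affinity'[OF this n, of 0]
  have "((\<lambda>p. kernel (real n *\<^sub>R p)) has_integral I / real n ^ 3) (cell (a, b, c))"
    using n by (simp add: cell_eq_cbox divide_inverse power3_eq_cube distrib_left mult.assoc[symmetric])
       (simp add: mult_ac)
  then have "((\<lambda>p. real n ^ 3 * kernel (real n *\<^sub>R p)) has_integral real n ^ 3 * (I / real n ^ 3)) (cell (a, b, c))"
    by (rule has_integral_mult_right)
  then have "(kernel has_integral I) (cell (a, b, c))"
    using n by (simp add: kernel_scale)
  then show ?thesis
    unfolding I_def cell_integral_def by (rule integral_unique)
qed

text \<open>
  The kernel decreases in every variable, and a cell has volume \<open>1\<close>: the integral lies between the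
  values at the two extreme corners.
\<close>
lemma cell_integral_bounds:
  assumes "a \<ge> 1" "b \<ge> 1" "c \<ge> 1"
  shows "cell_integral (a, b, c) \<le> lattice_term (a, b, c)"
    and "lattice_term (Suc a, Suc b, Suc c) \<le> cell_integral (a, b, c)"
proof -
  have const: "((\<lambda>_. t) has_integral t) (cell (a, b, c))" for t :: real
    using has_integral_const[of t "(real a, real b, real c)" "(real a + 1, real b + 1, real c + 1)"]
    by (simp add: cell_eq_cbox content_Pair)
  note I = cell_has_integral[OF assms]
  show "cell_integral (a, b, c) \<le> lattice_term (a, b, c)"
  proof (rule has_integral_le[OF I const])
    fix p assume "p \<in> cell (a, b, c)"
    then show "kernel p \<le> lattice_term (a, b, c)"
      using assms by (auto simp: cell_def kernel_def lattice_term_def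
          intro!: divide_left_mono mult_mono mult_pos_pos)
  qed
  show "lattice_term (Suc a, Suc b, Suc c) \<le> cell_integral (a, b, c)"
  proof (rule has_integral_le[OF const I])
    fix p assume "p \<in> cell (a, b, c)"
    then show "lattice_term (Suc a, Suc b, Suc c) \<le> kernel p"
      using assms by (auto simp: cell_def kernel_def lattice_term_def
          intro!: divide_left_mono mult_mono mult_pos_pos)
  qed
qed

section \<open>The integral over a shell\<close>

text \<open>
  The continuous shell \<open>a \<le> min x (min y z) < a + 1\<close> is, up to a null set, the union of the cells
  indexed by the discrete shell. Summing over those cells keeps every integral on a bounded domain.
\<close>
definition shell_integral :: "nat \<Rightarrow> real" where
  "shell_integral a = infsum cell_integral (shell a)"

lemma shell_positive:
  assumes "(x, y, z) \<in> shell a" "a \<ge> 1"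
  shows "x \<ge> 1" "y \<ge> 1" "z \<ge> 1"
  using assms by (auto simp: shell_def)

lemma shell_cell_bounds:
  assumes "m \<in> shell a" "a \<ge> 1"
  shows "cell_integral m \<ge> 0" "cell_integral m \<le> lattice_term m"
proof -
  obtain x y z where m: "m = (x, y, z)" by (cases m)
  have pos: "x \<ge> 1" "y \<ge> 1" "z \<ge> 1"
    using assms shell_positive unfolding m by blast+
  show "cell_integral m \<ge> 0"
    unfolding m using cell_integral_bounds(2)[OF pos] lattice_term_nonneg by (rule order_trans[rotated])
  show "cell_integral m \<le> lattice_term m"
    unfolding m by (rule cell_integral_bounds(1)[OF pos])
qed

lemma shell_integral_has_sum:
  assumes "a \<ge> 1"
  shows "(cell_integral has_sum shell_integral a) (shell a)"
proof -
  have "cell_integral summable_on shell a"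
    by (rule summable_on_comparison_test[OF has_sum_imp_summable[OF shell_sum[OF assms]]])
       (erule shell_cell_bounds[OF _ assms])+
  then show ?thesis
    unfolding shell_integral_def by (rule has_sum_infsum)
qed

text \<open>
  For the lower bound, the upper corners of the cells of one shell are precisely the points of the
  next shell.
\<close>
lemma shell_integral_bounds:
  assumes "a \<ge> 1"
  shows "shell_integral a \<le> 3 / 2 * zeta 2 / real a + 1 / (8 * real a ^ 3)"
    and "3 / 2 * zeta 2 / real (Suc a) \<le> shell_integral a"
proof -
  show "shell_integral a \<le> 3 / 2 * zeta 2 / real a + 1 / (8 * real a ^ 3)"
    using shell_integral_has_sum[OF assms] shell_sum[OF assms] shell_cell_bounds(2)[OF _ assms]
    by (rule has_sum_mono)
  let ?s = "\<lambda>(x, y, z). (Suc x, Suc y, Suc z)"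
  have "(lattice_term has_sum 3 / 2 * zeta 2 / real (Suc a) + 1 / (8 * real (Suc a) ^ 3)) (shell (Suc a))"
    by (rule shell_sum) simp
  then have "((\<lambda>m. lattice_term (?s m)) has_sum
      3 / 2 * zeta 2 / real (Suc a) + 1 / (8 * real (Suc a) ^ 3)) (shell a)"
    by (subst has_sum_reindex_bij_witness[of _ "\<lambda>(x, y, z). (x - 1, y - 1, z - 1)" ?s
          "shell (Suc a)" lattice_term]) (auto simp: shell_def)
  from this shell_integral_has_sum[OF assms]
  have "3 / 2 * zeta 2 / real (Suc a) + 1 / (8 * real (Suc a) ^ 3) \<le> shell_integral a"
  proof (rule has_sum_mono)
    fix m assume "m \<in> shell a"
    then show "lattice_term (?s m) \<le> cell_integral m"
      using assms by (cases m) (auto intro!: cell_integral_bounds(2) dest: shell_positive)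
  qed
  moreover have "1 / (8 * real (Suc a) ^ 3) \<ge> 0" by simp
  ultimately show "3 / 2 * zeta 2 / real (Suc a) \<le> shell_integral a" by linarith
qed

text \<open>
  The cells with \<open>n a \<le> min x (min y z) < n a + n\<close> can be grouped in two ways. Grouped by their
  minimum they form the shells on the right. Grouped by the quotients of the coordinates by \<open>n\<close>
  they form the subdivisions of the dilated cells of the shell of \<open>a\<close>, since the minimum commutes with
  division by \<open>n\<close>.
\<close>
lemma shell_integral_refine:
  assumes a: "a \<ge> 1" and n: "n \<ge> 1"
  shows "shell_integral a = (\<Sum>j\<in>{n * a..<n * a + n}. shell_integral j)"
proof -
  define U where "U = {(x, y, z). min x (min y z) \<in> {n * a..<n * a + n}}"
  have na: "n * a \<ge> 1" using assms by simp
  have "(cell_integral has_sum (\<Sum>j\<in>{n * a..<n * a + n}. shell_integral j)) U"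
  proof (rule has_sum_of_fibres[where h = "\<lambda>(x, y, z). min x (min y z)"])
    show "(shell_integral has_sum (\<Sum>j\<in>{n * a..<n * a + n}. shell_integral j)) {n * a..<n * a + n}"
      by simp
    show "(case m of (x, y, z) \<Rightarrow> min x (min y z)) \<in> {n * a..<n * a + n}" if "m \<in> U" for m
      using that by (cases m) (simp add: U_def)
    show "cell_integral m \<ge> 0" if "m \<in> U" for m
    proof -
      obtain x y z where m: "m = (x, y, z)" by (cases m)
      have "m \<in> shell (min x (min y z))" by (simp add: m shell_def)
      moreover have "min x (min y z) \<ge> 1"
        by (rule order_trans[OF na]) (use that in \<open>simp add: m U_def\<close>)
      ultimately show ?thesis by (rule shell_cell_bounds(1))
    qed
    fix j assume j: "j \<in> {n * a..<n * a + n}"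
    then have "{m \<in> U. (case m of (x, y, z) \<Rightarrow> min x (min y z)) = j} = shell j"
      by (auto simp: U_def shell_def)
    moreover have "j \<ge> 1"
      by (rule order_trans[OF na]) (use j in simp)
    ultimately show "(cell_integral has_sum shell_integral j)
        {m \<in> U. (case m of (x, y, z) \<Rightarrow> min x (min y z)) = j}"
      using shell_integral_has_sum by simp
  qed
  then have "(cell_integral has_sum (\<Sum>j\<in>{n * a..<n * a + n}. shell_integral j)) (shell a)"
  proof (rule has_sum_fibres[where h = "\<lambda>(x, y, z). (x div n, y div n, z div n)"])
    have div: "x div n = p \<longleftrightarrow> x \<in> {n * p..<n * p + n}" for x p
      using n dividend_less_times_div[of n x] by (auto simp: div_nat_eqI add.commute mult.commute)
    have below: "x < n * (x div n) + n" for x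
      using div[of x "x div n"] by simp
    have min_div: "min (x div n) (y div n) = min x y div n" for x y
      by (auto simp: min_def div_le_mono intro: antisym div_le_mono)
    show "(case m of (x, y, z) \<Rightarrow> (x div n, y div n, z div n)) \<in> shell a" if "m \<in> U" for m
      using that by (cases m) (simp add: U_def shell_def min_div div)
    fix p assume p: "p \<in> shell a"
    obtain p1 p2 p3 where p_eq: "p = (p1, p2, p3)" by (cases p)
    have pos: "p1 \<ge> 1" "p2 \<ge> 1" "p3 \<ge> 1"
      using p a shell_positive unfolding p_eq by blast+
    have "m \<in> U" if "m \<in> cube n (n * p1, n * p2, n * p3)" for m
    proof -
      obtain x y z where m: "m = (x, y, z)" by (cases m)
      have "x div n = p1" "y div n = p2" "z div n = p3"
        using that by (simp_all add: m cube_def div)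
      then have "min x (min y z) div n = a"
        using p by (simp add: p_eq shell_def flip: min_div)
      then show ?thesis by (simp add: U_def m div)
    qed
    then have "{m \<in> U. (case m of (x, y, z) \<Rightarrow> (x div n, y div n, z div n)) = p}
                 = cube n (n * p1, n * p2, n * p3)"
      by (auto simp: p_eq cube_def div below)
    moreover have "(cell_integral has_sum cell_integral p) (cube n (n * p1, n * p2, n * p3))"
      unfolding p_eq using cell_integral_subdivide[OF pos n] by (intro has_sum_finiteI) (auto simp: cube_def)
    ultimately show "(cell_integral has_sum cell_integral p)
        {m \<in> U. (case m of (x, y, z) \<Rightarrow> (x div n, y div n, z div n)) = p}"
      by simp
  qed
  with shell_integral_has_sum[OF a] show ?thesis
    by (rule has_sum_unique)
qed

lemma zeta_2_nonneg: "zeta 2 \<ge> 0"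
  unfolding zeta_def by (intro suminf_nonneg sums_summable[OF zeta_sums]) auto

lemma ln_ratio_bounds:
  assumes "j \<ge> 1"
  shows "1 / real (Suc j) \<le> ln (real (Suc j)) - ln (real j)"
    and "ln (real (Suc j)) - ln (real j) \<le> 1 / real j"
proof -
  have j: "real j > 0" using assms by simp
  have "ln (real (Suc j)) - ln (real j) = ln (real (Suc j) / real j)"
    using j by (simp add: ln_div)
  also have "\<dots> \<le> real (Suc j) / real j - 1"
    using j by (intro ln_le_minus_one) simp
  finally show "ln (real (Suc j)) - ln (real j) \<le> 1 / real j"
    using j by (simp add: field_simps)
  have "ln (real j) - ln (real (Suc j)) = ln (real j / real (Suc j))"
    using j by (simp add: ln_div)
  also have "\<dots> \<le> real j / real (Suc j) - 1"
    using j by (intro ln_le_minus_one) simp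
  also have "\<dots> = - (1 / real (Suc j))"
    by (simp add: field_simps)
  finally show "1 / real (Suc j) \<le> ln (real (Suc j)) - ln (real j)"
    by simp
qed

text \<open>
  The shell integral and the logarithm are both additive under the refinement by \<open>n\<close>, hence so is
  their difference \<open>e\<close>. A telescoping bound for \<open>e j\<close> then bounds \<open>e a\<close> by \<open>O(1 / n)\<close> for every \<open>n\<close>.
\<close>
lemma shell_integral_eq:
  assumes a: "a \<ge> 1"
  shows "shell_integral a = 3 / 2 * zeta 2 * (ln (real (Suc a)) - ln (real a))"
proof -
  define K where "K = 3 / 2 * zeta 2"
  have K: "K \<ge> 0" using zeta_2_nonneg by (simp add: K_def)
  define e where "e j = shell_integral j - K * (ln (real (Suc j)) - ln (real j))" for j
  have e_bound: "\<bar>e j\<bar> \<le> (K + 1) * (1 / real j - 1 / real (Suc j))" if j: "j \<ge> 1" for j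
  proof -
    have "K * (1 / real (Suc j)) \<le> K * (ln (real (Suc j)) - ln (real j))"
         "K * (ln (real (Suc j)) - ln (real j)) \<le> K * (1 / real j)"
      using K by (intro mult_left_mono ln_ratio_bounds j; simp)+
    moreover have "1 / (8 * real j ^ 3) \<le> 1 / real j - 1 / real (Suc j)"
    proof -
      have "real j * 1 \<le> real j * real j" "real j ^ 2 * 1 \<le> real j ^ 2 * real j"
        using j by (intro mult_left_mono; simp)+
      then have "real j * real (Suc j) \<le> 8 * real j ^ 3"
        by (simp add: power2_eq_square power3_eq_cube algebra_simps)
      then have "1 / (8 * real j ^ 3) \<le> 1 / (real j * real (Suc j))"
        using j by (intro divide_left_mono) auto
      also have "\<dots> = 1 / real j - 1 / real (Suc j)"
        using j by (simp add: field_simps)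
      finally show ?thesis .
    qed
    moreover have "1 / real j - 1 / real (Suc j) \<ge> 0"
      using j by (simp add: frac_le)
    moreover have "shell_integral j \<le> K * (1 / real j) + 1 / (8 * real j ^ 3)"
                  "K * (1 / real (Suc j)) \<le> shell_integral j"
      using shell_integral_bounds[OF j] by (simp_all add: K_def)
    moreover have "(K + 1) * (1 / real j - 1 / real (Suc j))
        = K * (1 / real j) - K * (1 / real (Suc j)) + (1 / real j - 1 / real (Suc j))"
      by (simp only: distrib_right right_diff_distrib mult_1)
    ultimately show ?thesis
      unfolding e_def abs_le_iff by linarith
  qed
  have "\<bar>e a\<bar> \<le> (K + 1) / real n" if n: "n \<ge> 1" for n
  proof -
    have na: "n * a \<ge> 1" using a n by simp
    have "(\<Sum>j\<in>{n * a..<n * a + n}. ln (real (Suc j)) - ln (real j)) = ln (real (n * a + n)) - ln (real (n * a))"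
      by (rule sum_Suc_diff') simp
    also have "\<dots> = ln (real (Suc a)) - ln (real a)"
    proof -
      have "n * a + n = n * Suc a" by simp
      then show ?thesis using a n by (simp only: of_nat_mult) (simp add: ln_mult)
    qed
    finally have "e a = (\<Sum>j\<in>{n * a..<n * a + n}. e j)"
      unfolding e_def shell_integral_refine[OF a n] by (simp add: sum_subtractf flip: sum_distrib_left)
    also have "\<bar>\<dots>\<bar> \<le> (\<Sum>j\<in>{n * a..<n * a + n}. (K + 1) * (1 / real j - 1 / real (Suc j)))"
      by (intro order_trans[OF sum_abs] sum_mono e_bound order_trans[OF na]) auto
    also have "\<dots> = (K + 1) * (\<Sum>j\<in>{n * a..<n * a + n}. - (1 / real (Suc j)) - - (1 / real j))"
      by (simp add: sum_distrib_left)
    also have "(\<Sum>j\<in>{n * a..<n * a + n}. - (1 / real (Suc j)) - - (1 / real j))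
                 = - (1 / real (n * a + n)) - - (1 / real (n * a))"
      by (rule sum_Suc_diff') simp
    also have "(K + 1) * \<dots> \<le> (K + 1) * (1 / real n)"
    proof (rule mult_left_mono)
      have "real n * 1 \<le> real n * real a" using a by (intro mult_left_mono) auto
      then have "1 / real (n * a) \<le> 1 / real n"
        using n by (intro divide_left_mono) auto
      moreover have "1 / real (n * a + n) \<ge> 0" by simp
      ultimately show "- (1 / real (n * a + n)) - - (1 / real (n * a)) \<le> 1 / real n" by linarith
    qed (use K in simp)
    finally show ?thesis by simp
  qed
  moreover have "(\<lambda>n. (K + 1) / real n) \<longlonglongrightarrow> 0"
    by (rule lim_const_over_n)
  ultimately have "\<bar>e a\<bar> \<le> 0"
    by (intro LIMSEQ_le_const[where X = "\<lambda>n. (K + 1) / real n"]) auto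
  then show ?thesis
    by (simp add: e_def K_def)
qed

section \<open>Summing the defects\<close>

lemma defect_sum:
  "((\<lambda>m. lattice_term m - cell_integral m) has_sum
      3 / 2 * zeta 2 * euler_mascheroni + 1 / 8 * zeta 3) ({1..} \<times> {1..} \<times> {1..})"
proof (rule has_sum_of_fibres[where h = "\<lambda>(x, y, z). min x (min y z)" and A = "{1..}"])
  let ?D = "\<lambda>a. 3 / 2 * zeta 2 / real a + 1 / (8 * real a ^ 3) - shell_integral a"
  have shell: "{m \<in> {1..} \<times> {1..} \<times> {1..}. (case m of (x, y, z) \<Rightarrow> min x (min y z)) = a} = shell a"
    if "a \<ge> 1" for a
    using that by (auto simp: shell_def)
  show "(\<lambda>m. lattice_term m - cell_integral m) m \<ge> 0" if "m \<in> {1..} \<times> {1..} \<times> {1..}" for m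
    using that by (cases m) (auto simp: intro!: cell_integral_bounds(1))
  show "((\<lambda>m. lattice_term m - cell_integral m) has_sum ?D a)
          {m \<in> {1..} \<times> {1..} \<times> {1..}. (case m of (x, y, z) \<Rightarrow> min x (min y z)) = a}"
    if "a \<in> {1..}" for a
  proof -
    have a: "a \<ge> 1" using that by simp
    have "((\<lambda>m. - cell_integral m) has_sum - shell_integral a) (shell a)"
      using shell_integral_has_sum[OF a] by (simp add: has_sum_uminus)
    from has_sum_add[OF shell_sum[OF a] this] show ?thesis
      unfolding shell[OF a] by simp
  qed
  have "((\<lambda>i. ?D (Suc i)) has_sum 3 / 2 * zeta 2 * euler_mascheroni + 1 / 8 * zeta 3) UNIV"
  proof (rule sums_nonneg_imp_has_sum)
    show "?D (Suc i) \<ge> 0" for i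
      using shell_integral_bounds(1)[of "Suc i"] by simp
    have "(\<lambda>i. 3 / 2 * zeta 2 * (inverse (of_nat (i + 1)) + ln (of_nat (i + 1)) - ln (of_nat (i + 2)))
             + 1 / 8 * (1 / real (Suc i) powr 3))
          sums (3 / 2 * zeta 2 * euler_mascheroni + 1 / 8 * zeta 3)"
      by (intro sums_add sums_mult euler_mascheroni_sum_real zeta_sums) simp
    also have "(\<lambda>i. 3 / 2 * zeta 2 * (inverse (of_nat (i + 1)) + ln (of_nat (i + 1)) - ln (of_nat (i + 2)))
             + 1 / 8 * (1 / real (Suc i) powr 3)) = (\<lambda>i. ?D (Suc i))"
    proof
      fix i :: nat
      have "real (Suc i) powr 3 = real (Suc i) ^ 3" by (rule powr_numeral) simp
      moreover have "inverse (of_nat (i + 1)) = 1 / real (Suc i)"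
        by (simp add: divide_inverse)
      moreover have "shell_integral (Suc i) = 3 / 2 * zeta 2 * (ln (of_nat (i + 2)) - ln (of_nat (i + 1)))"
        using shell_integral_eq[of "Suc i"] by simp
      ultimately show "3 / 2 * zeta 2 * (inverse (of_nat (i + 1)) + ln (of_nat (i + 1)) - ln (of_nat (i + 2)))
             + 1 / 8 * (1 / real (Suc i) powr 3) = ?D (Suc i)"
        by (simp only:) (simp add: distrib_left right_diff_distrib)
    qed
    finally show "(\<lambda>i. ?D (Suc i)) sums (3 / 2 * zeta 2 * euler_mascheroni + 1 / 8 * zeta 3)" .
  qed
  then show "(?D has_sum 3 / 2 * zeta 2 * euler_mascheroni + 1 / 8 * zeta 3) {1..}"
    by (subst has_sum_reindex_bij_witness[of _ Suc "\<lambda>a. a - 1" UNIV "\<lambda>i. ?D (Suc i)"]) auto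
qed (auto simp: split_beta)

lemma f_eq_defect_sum:
  assumes "k \<ge> 1"
  shows "f k = (\<Sum>m\<in>cube k (1, 1, 1). lattice_term m - cell_integral m)"
proof -
  have "{1..k} = {1..<1 + k}" by auto
  then have cube: "cube k (1, 1, 1) = {1..k} \<times> {1..k} \<times> {1..k}"
    by (simp add: cube_def)
  have box: "integral ({1..real k + 1} \<times> {1..real k + 1} \<times> {1..real k + 1})
          (\<lambda>(x, y, z). 1 / ((x + y) * (y + z) * (z + x))) = (\<Sum>m\<in>cube k (1, 1, 1). cell_integral m)"
    using cube_has_integral[of 1 1 1 k] assms
    by (intro integral_unique) (simp add: kernel_def add.commute)
  show ?thesis
    by (simp only: f_def box sum_subtractf cube lattice_term_def)
qed

theorem theorem1p3:
  shows "f \<longlonglongrightarrow> 3 / 2 * zeta 2 * euler_mascheroni + 1 / 8 * zeta 3"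
proof -
  let ?P = "{1..} \<times> {1..} \<times> {1..} :: (nat \<times> nat \<times> nat) set"
  have "filterlim (\<lambda>k. cube k (1, 1, 1)) (finite_subsets_at_top ?P) sequentially"
    unfolding filterlim_finite_subsets_at_top
  proof (intro allI impI, elim conjE)
    fix X assume X: "finite X" "X \<subseteq> ?P"
    (* The inserted 0 keeps the maximum defined when X is empty. *)
    let ?M = "Max (insert 0 ((\<lambda>(x, y, z). max x (max y z)) ` X))"
    have "X \<subseteq> cube k (1, 1, 1)" if k: "k \<ge> ?M" for k
    proof
      fix m assume m: "m \<in> X"
      obtain x y z where m_eq: "m = (x, y, z)" by (cases m)
      have "max x (max y z) \<le> ?M"
        using m X(1) unfolding m_eq by (intro Max_ge) force+
      moreover have "m \<in> ?P" using m X(2) by blast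
      ultimately show "m \<in> cube k (1, 1, 1)"
        using k by (simp add: m_eq cube_def)
    qed
    then have "eventually (\<lambda>k. X \<subseteq> cube k (1, 1, 1)) sequentially"
      unfolding eventually_sequentially by blast
    then show "\<forall>\<^sub>F k in sequentially. finite (cube k (1, 1, 1)) \<and> X \<subseteq> cube k (1, 1, 1)
                 \<and> cube k (1, 1, 1) \<subseteq> ?P"
      by eventually_elim (auto simp: cube_def)
  qed
  from filterlim_compose[OF defect_sum[unfolded has_sum_def] this]
  have "(\<lambda>k. \<Sum>m\<in>cube k (1, 1, 1). lattice_term m - cell_integral m)
          \<longlonglongrightarrow> 3 / 2 * zeta 2 * euler_mascheroni + 1 / 8 * zeta 3" .
  moreover have "\<forall>\<^sub>F k in sequentially.
      (\<Sum>m\<in>cube k (1, 1, 1). lattice_term m - cell_integral m) = f k"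
    using eventually_ge_at_top[of 1] by eventually_elim (rule f_eq_defect_sum[symmetric])
  ultimately show ?thesis
    by (rule Lim_transform_eventually)
qed

end
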